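(* For every $s\in\mathbb{C}$, $$(s-1)\zeta(s)=\sum_{k=0}^\infty A_k\, P_k\!\left(\frac{s}{2}\right),$$ where $\zeta$ is the Riemann zeta function (with the left side understood at $s=1$ via analytic continuation, i.e. as the entire function $(s-1)\zeta(s)$), and the series converges absolutely and uniformly on every compact subset of $\mathbb{C}$.
   Context: For integers $k\ge 0$ define $A_k:=\sum_{j=0}^k (-1)^j\binom{k}{j}(2j+1)\zeta(2j+2)$, and the Pochhammer polynomials $P_k(s):=\prod_{r=1}^k\left(1-\frac{s}{r}\right)$ for $k\ge1$, with $P_0(s):=1$. *)

theory Defs
  imports "HOL-Complex_Analysis.Complex_Analysis"
begin

text \<open>
  The Riemann zeta function: the analytic continuation to the punctured plane of the Dirichlet
  series that defines it for real part greater than 1. Such a continuation exists, and it is unique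
  by the identity theorem; its value at the pole 1, where it is mathematically undefined, is
  normalised to 0 so that the description determines a total function.
\<close>
definition zeta :: "complex \<Rightarrow> complex" where
  "zeta = (THE f. f holomorphic_on (- {1}) \<and>
                  (\<forall>s. Re s > 1 \<longrightarrow> (\<lambda>n. 1 / of_nat (Suc n) powr s) sums f s) \<and>
                  f 1 = 0)"

text \<open>
  The entire function \<open>(s - 1) * zeta s\<close>: the pointwise product with its removable singularity
  at 1 filled in by the limit. In particular the normalisation \<open>zeta 1 = 0\<close> plays no role here.
\<close>
definition entire_zeta :: "complex \<Rightarrow> complex" where
  "entire_zeta = remove_sings (\<lambda>s. (s - 1) * zeta s)"

definition A :: "nat \<Rightarrow> complex" where
  "A k = (\<Sum>j=0..k. (- 1) ^ j * of_nat (k choose j) * of_nat (2 * j + 1) * zeta (of_nat (2 * j + 2)))"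

definition P :: "nat \<Rightarrow> complex \<Rightarrow> complex" where
  "P k s = (\<Prod>r=1..k. 1 - s / of_nat r)"

end

(*
  Put h_k(z) = (1 - 1/z^2)^k / z. Expanding the power shows that A_k is minus the sum of h_k'(n)
  over n >= 1. On the disc |z - t| <= t/10 with t >= 1 one has |h_k(z)| <= (2/t) exp(-k/(2 t^2)),
  so by Cauchy's estimates high derivatives of h_k are small, and comparing sums of derivatives
  at the integers through Taylor's formula gives A_k = O(k^-N) for every N. As P_k grows only
  polynomially, locally uniformly in s, the series converges to an entire function E.
  For s near 7 the double sum over k and n may be interchanged, and the binomial series
  sum_k P_k(s) y^k = (1 - y)^(s-1) turns it into (s - 1) times the Dirichlet series.
  By the identity theorem E(s)/(s - 1) is the continuation of zeta, which also proves that zeta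
  exists.
*)
theory Submission
  imports Defs
begin

section \<open>Size of the kernel and its derivatives on the positive axis\<close>

definition kernel :: "nat \<Rightarrow> complex \<Rightarrow> complex" where
  "kernel k z = (1 - 1 / z ^ 2) ^ k / z"

lemma kernel_holomorphic: "kernel k holomorphic_on - {0}"
  unfolding kernel_def by (intro holomorphic_intros) auto

lemma norm_inverse_square_minus_one_le:
  fixes w :: complex
  assumes "norm (w - 1) \<le> 1 / 10"
  shows "norm (1 / w ^ 2 - 1) \<le> 1 / 2"
proof -
  have lower: "norm w \<ge> 9 / 10"
    using norm_triangle_ineq2[of 1 "1 - w"] assms by (simp add: norm_minus_commute)
  have upper: "norm (1 + w) \<le> 21 / 10"
    using norm_triangle_ineq[of 2 "w - 1"] assms by simp
  have "w \<noteq> 0" using lower by auto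
  then have "1 / w ^ 2 - 1 = (1 - w) * (1 + w) / w ^ 2"
    by (simp add: field_simps power2_eq_square)
  then have "norm (1 / w ^ 2 - 1) = norm (w - 1) * norm (1 + w) / norm w ^ 2"
    by (simp add: norm_mult norm_divide norm_power norm_minus_commute)
  also have "\<dots> \<le> (1 / 10) * (21 / 10) / (9 / 10) ^ 2"
    using assms lower upper by (intro frac_le mult_mono power_mono) auto
  finally show ?thesis by (simp add: power2_eq_square)
qed

text \<open>With z = t w and u = 1/t^2 one has 1 - 1/z^2 = (1 - u) - u (1/w^2 - 1). The last bracket
  has norm at most 1/2, so the norm is at most 1 - u/2 \<le> exp(-u/2), and the k-th power gives the
  exponential factor.\<close>

lemma norm_kernel_le:
  fixes t :: real
  assumes t: "t \<ge> 1" and z: "norm (z - of_real t) \<le> t / 10"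
  shows "norm (kernel k z) \<le> 2 / t * exp (- (real k / (2 * t ^ 2)))"
proof -
  define w where "w = z / of_real t"
  define u where "u = 1 / t ^ 2"
  have u: "0 < u" "u \<le> 1" using t by (simp_all add: u_def)
  have zw: "z = of_real t * w" using t by (simp add: w_def)
  have "z - of_real t = of_real t * (w - 1)" by (simp add: zw algebra_simps)
  then have "norm (z - of_real t) = t * norm (w - 1)" using t by (simp add: norm_mult)
  then have w: "norm (w - 1) \<le> 1 / 10" using z t by (simp add: field_simps)
  have "1 - 1 / z ^ 2 = of_real (1 - u) - of_real u * (1 / w ^ 2 - 1)"
    using t by (simp add: zw u_def power_mult_distrib algebra_simps)
  also have "norm \<dots> \<le> (1 - u) + u * (1 / 2)"
    using u norm_inverse_square_minus_one_le[OF w]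
    by (intro order.trans[OF norm_triangle_ineq4] add_mono)
       (simp_all add: norm_mult abs_of_nonneg del: of_real_diff)
  also have "\<dots> \<le> exp (- u / 2)" using exp_ge_add_one_self[of "- u / 2"] by simp
  finally have "norm (1 - 1 / z ^ 2) ^ k \<le> exp (- u / 2) ^ k"
    by (intro power_mono) auto
  also have "\<dots> = exp (- (real k / (2 * t ^ 2)))"
    by (simp add: u_def field_simps flip: exp_of_nat_mult)
  finally have num: "norm (1 - 1 / z ^ 2) ^ k \<le> exp (- (real k / (2 * t ^ 2)))" .
  have "norm z \<ge> t / 2"
    using norm_triangle_ineq2[of "of_real t" "of_real t - z"] z t by (simp add: norm_minus_commute)
  then have "norm (1 - 1 / z ^ 2) ^ k / norm z \<le> exp (- (real k / (2 * t ^ 2))) / (t / 2)"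
    using num t by (intro frac_le) auto
  then show ?thesis
    by (simp add: kernel_def norm_divide norm_power mult.commute)
qed

text \<open>Cauchy's inequality on a disc whose radius t/10 is proportional to t: every
  differentiation gains a factor 1/t, while the exponential decay in k is kept.\<close>

lemma norm_higher_deriv_kernel_le:
  fixes t :: real
  assumes t: "t \<ge> 1"
  shows "norm ((deriv ^^ i) (kernel k) (of_real t)) \<le>
    2 * fact i * 10 ^ i / t ^ Suc i * exp (- (real k / (2 * t ^ 2)))"
proof -
  define r where "r = t / 10"
  have nz: "cball (of_real t) r \<subseteq> - {0 :: complex}"
    using t by (auto simp: r_def)
  have "norm ((deriv ^^ i) (kernel k) (of_real t)) \<le>
      fact i * (2 / t * exp (- (real k / (2 * t ^ 2)))) / r ^ i"
  proof (rule Cauchy_inequality)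
    show "kernel k holomorphic_on ball (of_real t) r"
      using order.trans[OF ball_subset_cball nz] by (rule holomorphic_on_subset[OF kernel_holomorphic])
    show "continuous_on (cball (of_real t) r) (kernel k)"
      by (intro holomorphic_on_imp_continuous_on holomorphic_on_subset[OF kernel_holomorphic] nz)
    show "0 < r" using t by (simp add: r_def)
    fix z :: complex assume "norm (of_real t - z) = r"
    then show "norm (kernel k z) \<le> 2 / t * exp (- (real k / (2 * t ^ 2)))"
      by (intro norm_kernel_le[OF t]) (simp add: r_def norm_minus_commute)
  qed
  also have "\<dots> = 2 * fact i * 10 ^ i / t ^ Suc i * exp (- (real k / (2 * t ^ 2)))"
    by (simp add: r_def power_divide)
  finally show ?thesis .
qed

section \<open>Rapid decay of the coefficients\<close>

lemma exp_minus_le_inverse_power: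
  fixes x :: real
  assumes "x > 0"
  shows "exp (- x) \<le> fact N / x ^ N"
proof -
  have "x ^ N / fact N = (\<Sum>n\<in>{N}. x ^ n / fact n)" by simp
  also have "\<dots> \<le> (\<Sum>n. x ^ n / fact n)"
    using assms summable_exp_generic[of x]
    by (intro sum_le_suminf) (auto simp: field_simps)
  also have "\<dots> = exp x" by (simp add: exp_def field_simps)
  finally have "x ^ N / fact N \<le> exp x" .
  then show ?thesis using assms by (simp add: exp_minus field_simps)
qed

text \<open>
  An Euler--Maclaurin estimate without Bernoulli numbers: telescoping the Taylor expansion of
  \<open>F j\<close> from each integer to the next expresses the sum of \<open>F (Suc j)\<close> through sums of higher
  derivatives.
\<close>
lemma norm_sum_derivs_le:
  fixes F :: "nat \<Rightarrow> complex \<Rightarrow> complex" and B :: "nat \<Rightarrow> real"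
  assumes deriv: "\<And>i n x. i \<le> m \<Longrightarrow> x \<in> closed_segment (of_nat (Suc n)) (of_nat (Suc (Suc n))) \<Longrightarrow>
      (F i has_field_derivative F (Suc i) x) (at x)"
    and lim: "\<And>i. i < m \<Longrightarrow> (\<lambda>n. F i (of_nat (Suc n))) \<longlonglongrightarrow> 0"
    and summ: "\<And>i. i < m \<Longrightarrow> summable (\<lambda>n. F (Suc i) (of_nat (Suc n)))"
    and bound: "\<And>n x. x \<in> closed_segment (of_nat (Suc n)) (of_nat (Suc (Suc n))) \<Longrightarrow>
      norm (F (Suc m) x) \<le> B n"
    and B: "summable B"
    and boundary: "\<And>i. i < m \<Longrightarrow> norm (F i 1) \<le> b"
    and j: "j < m"
  shows "norm (\<Sum>n. F (Suc j) (of_nat (Suc n))) \<le> 2 ^ (m - Suc j) * (b + suminf B)"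
  using j
\<comment> \<open>Downward induction on \<open>j\<close>: the sums of the higher derivatives in the
  Taylor expansion of \<open>F j\<close> are already bounded.\<close>
proof (induction "m - j" arbitrary: j rule: less_induct)
  case less
  define S where "S i = (\<Sum>n. F i (of_nat (Suc n)))" for i
  define d where "d = m - Suc j"
  have m: "m = Suc (j + d)" using less.prems by (simp add: d_def)
  define c where "c = b + suminf B"
  \<comment> \<open>The Taylor remainder on one unit step. The expansion runs up to
    \<open>F m\<close>, so the remainder is controlled by \<open>F (Suc m)\<close>, for which
    \<open>B\<close> is a summable bound.\<close>
  define e where "e n = F j (of_nat (Suc (Suc n))) - F j (of_nat (Suc n))
      - (\<Sum>i\<le>d. F (j + Suc i) (of_nat (Suc n)) / fact (Suc i))" for n
  have B0: "0 \<le> B n" for n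
    using order.trans[OF norm_ge_zero bound[OF ends_in_segment(1), of n]] .
  have e_le: "norm (e n) \<le> B n" for n
  proof -
    let ?S = "closed_segment (of_nat (Suc n)) (of_nat (Suc (Suc n))) :: complex set"
    have "norm (F (j + 0) (of_nat (Suc (Suc n))) -
        (\<Sum>i\<le>Suc d. F (j + i) (of_nat (Suc n)) * (of_nat (Suc (Suc n)) - of_nat (Suc n)) ^ i / fact i))
      \<le> B n * norm (of_nat (Suc (Suc n)) - of_nat (Suc n) :: complex) ^ Suc (Suc d) / fact (Suc d)"
    proof (rule complex_Taylor[of ?S "Suc d" "\<lambda>i. F (j + i)"])
      fix i x assume "x \<in> ?S" "i \<le> Suc d"
      then show "(F (j + i) has_field_derivative F (j + Suc i) x) (at x within ?S)"
        using deriv[of "j + i" x n] m by (auto intro: has_field_derivative_at_within)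
    next
      fix x assume "x \<in> ?S"
      then show "norm (F (j + Suc (Suc d)) x) \<le> B n" using bound[of x n] m by simp
    qed auto
    also have "\<dots> \<le> B n * 1 / 1"
      using B0[of n] by (intro frac_le) (auto simp: fact_ge_1 simp del: fact_Suc)
    also have "F (j + 0) (of_nat (Suc (Suc n))) -
        (\<Sum>i\<le>Suc d. F (j + i) (of_nat (Suc n)) * (of_nat (Suc (Suc n)) - of_nat (Suc n)) ^ i / fact i) = e n"
      by (simp add: e_def sum.atMost_Suc_shift del: fact_Suc sum.atMost_Suc)
    finally show ?thesis by simp
  qed
  have sums_S: "(\<lambda>n. F (j + Suc i) (of_nat (Suc n))) sums S (j + Suc i)" if "i \<le> d" for i
    using summ[of "j + i"] that m by (simp add: S_def summable_sums)
  have "(\<lambda>n. F j (of_nat (Suc (Suc n))) - F j (of_nat (Suc n))) sums (0 - F j 1)"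
    using telescope_sums[OF lim[OF less.prems]] by simp
  moreover have "(\<lambda>n. \<Sum>i\<le>d. F (j + Suc i) (of_nat (Suc n)) / fact (Suc i)) sums
      (\<Sum>i\<le>d. S (j + Suc i) / fact (Suc i))"
    using sums_S by (intro sums_sum sums_divide) auto
  ultimately have "e sums (0 - F j 1 - (\<Sum>i\<le>d. S (j + Suc i) / fact (Suc i)))"
    unfolding e_def by (rule sums_diff)
  moreover have "(\<Sum>i\<le>d. S (j + Suc i) / fact (Suc i)) =
      S (Suc j) + (\<Sum>i<d. S (j + Suc (Suc i)) / fact (Suc (Suc i)))"
    by (simp add: sum.lessThan_Suc_shift flip: lessThan_Suc_atMost del: sum.lessThan_Suc fact_Suc)
  ultimately have "S (Suc j) = - F j 1 - suminf e - (\<Sum>i<d. S (j + Suc (Suc i)) / fact (Suc (Suc i)))"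
    by (simp add: sums_iff del: fact_Suc)
  then have "norm (S (Suc j)) \<le> norm (F j 1) + norm (suminf e) +
      norm (\<Sum>i<d. S (j + Suc (Suc i)) / fact (Suc (Suc i)))"
    by (smt (verit) norm_minus_cancel norm_triangle_ineq4)
  also have "\<dots> \<le> b + suminf B + (\<Sum>i<d. 2 ^ (d - Suc i) * c)"
  proof (intro add_mono boundary less.prems norm_suminf_le B e_le order.trans[OF norm_sum] sum_mono)
    fix i assume i: "i \<in> {..<d}"
    have "norm (S (j + Suc (Suc i)) / fact (Suc (Suc i))) \<le> norm (S (j + Suc (Suc i))) / 1"
      unfolding norm_divide by (intro frac_le) (auto simp: fact_ge_1 norm_fact simp del: fact_Suc)
    also have "\<dots> \<le> 2 ^ (d - Suc i) * c"
      using less.hyps[of "j + Suc i"] i m by (simp add: S_def c_def)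
    finally show "norm (S (j + Suc (Suc i)) / fact (Suc (Suc i))) \<le> 2 ^ (d - Suc i) * c" .
  qed
  \<comment> \<open>Since 1 + (1 + 2 + ... + 2^(d-1)) = 2^d, the bound doubles with each step down
    in \<open>j\<close>.\<close>
  also have "\<dots> = c * (1 + (\<Sum>i<d. 2 ^ (d - Suc i)))"
    by (simp add: c_def sum_distrib_left algebra_simps)
  also have "(\<Sum>i<d. 2 ^ (d - Suc i) :: real) = (\<Sum>i<d. 2 ^ i)"
    by (rule sum.nat_diff_reindex)
  also have "\<dots> = 2 ^ d - 1" by (simp add: geometric_sum)
  finally show ?case by (simp add: S_def c_def d_def mult.commute)
qed

text \<open>This is \<open>A k\<close> in a form that avoids \<open>zeta\<close>. The definite
  description behind \<open>zeta\<close> can be evaluated only after the series with these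
  coefficients has supplied the continuation.\<close>

definition kernel_coeff :: "nat \<Rightarrow> complex" where
  "kernel_coeff k = (\<Sum>n. - deriv (kernel k) (of_nat (Suc n)))"

lemma closed_segment_of_natE:
  fixes x :: complex
  assumes "x \<in> closed_segment (of_nat (Suc n)) (of_nat (Suc (Suc n)))"
  obtains t where "x = of_real t" "real (Suc n) \<le> t"
proof -
  from assms obtain u where u: "0 \<le> u" "x = (1 - of_real u) * of_nat (Suc n) + of_real u * of_nat (Suc (Suc n))"
    by (auto simp: in_segment scaleR_conv_of_real)
  then have "x = of_real (real (Suc n) + u)" by (simp add: algebra_simps)
  with u(1) show ?thesis by (intro that[of "real (Suc n) + u"]) auto
qed

lemma summable_inverse_Suc_power:
  assumes "p \<ge> 2"
  shows "summable (\<lambda>n. 1 / real (Suc n) ^ p)"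
  using inverse_power_summable[of p, where 'a = real] assms
  by (subst summable_Suc_iff[of "\<lambda>n. 1 / real n ^ p"]) (simp add: field_simps)

lemma norm_higher_deriv_kernel_le_inverse_power:
  assumes "t \<ge> 1"
  shows "norm ((deriv ^^ i) (kernel k) (of_real t)) \<le> 2 * fact i * 10 ^ i / t ^ Suc i"
proof -
  have "2 * fact i * 10 ^ i / t ^ Suc i * exp (- (real k / (2 * t ^ 2))) \<le>
      2 * fact i * 10 ^ i / t ^ Suc i * 1"
    using assms by (intro mult_left_mono) auto
  then show ?thesis using norm_higher_deriv_kernel_le[OF assms, of i k] by linarith
qed

lemma summable_higher_deriv_kernel:
  "summable (\<lambda>n. norm ((deriv ^^ Suc i) (kernel k) (of_nat (Suc n))))"
proof (rule summable_comparison_test')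
  show "summable (\<lambda>n. 2 * fact (Suc i) * 10 ^ Suc i * (1 / real (Suc n) ^ Suc (Suc i)))"
    by (intro summable_mult summable_inverse_Suc_power) auto
  show "norm (norm ((deriv ^^ Suc i) (kernel k) (of_nat (Suc n)))) \<le>
      2 * fact (Suc i) * 10 ^ Suc i * (1 / real (Suc n) ^ Suc (Suc i))" for n
    using norm_higher_deriv_kernel_le_inverse_power[of "real (Suc n)" "Suc i" k]
    by (simp del: fact_Suc power_Suc of_nat_Suc funpow.simps)
qed

text \<open>Trading exp(-k/(2 t^2)) for k^-N costs a factor of order t^(2N), while the i-th
  derivative of the kernel brings t^-(i+1). Hence the derivative of order 2N + 1 is still O(t^-2
  k^-N), which is summable over the integers, and the boundary terms at t = 1 are O(k^-N). The
  Taylor comparison passes this bound on to the sum of first derivatives.\<close>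

lemma kernel_coeff_decay:
  assumes N: "N > 0"
  shows "\<exists>C. \<forall>k>0. norm (kernel_coeff k) \<le> C / real k ^ N"
proof -
  define m where "m = 2 * N"
  define K :: real where "K = 2 * fact (Suc m) * 10 ^ Suc m * (fact N * 2 ^ N)"
  define Z where "Z = (\<Sum>n. 1 / real (Suc n) ^ 2)"
  have "norm (kernel_coeff k) \<le> (2 ^ (m - 1) * K * (1 + Z)) / real k ^ N" if k: "k > 0" for k
  proof -
    define F where "F i = (deriv ^^ i) (kernel k)" for i
    define B where "B n = K / real k ^ N * (1 / real (Suc n) ^ 2)" for n
    have K0: "K \<ge> 0" by (simp add: K_def)
    have exp_le: "exp (- (real k / (2 * t ^ 2))) \<le> fact N * 2 ^ N * t ^ m / real k ^ N"
      if "t \<ge> 1" for t :: real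
      unfolding m_def power_mult using exp_minus_le_inverse_power[of "real k / (2 * t ^ 2)" N] k that
      by (simp add: power_divide power_mult_distrib mult_ac)
    have F_le: "norm (F i (of_real t)) \<le> K * t ^ m / t ^ Suc i / real k ^ N"
      if t: "t \<ge> 1" and i: "i \<le> Suc m" for t i
    proof -
      have "norm (F i (of_real t)) \<le>
          2 * fact (Suc m) * 10 ^ Suc m / t ^ Suc i * (fact N * 2 ^ N * t ^ m / real k ^ N)"
        unfolding F_def
      proof (rule order.trans[OF norm_higher_deriv_kernel_le[OF t]], intro mult_mono exp_le t divide_right_mono)
        show "fact i \<le> (fact (Suc m) :: real)" by (rule fact_mono[OF i])
        show "10 ^ i \<le> (10 ^ Suc m :: real)" using i by (intro power_increasing) auto
      qed (use t in auto)
      also have "\<dots> = K * t ^ m / t ^ Suc i / real k ^ N"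
        by (simp only: K_def times_divide_eq_left times_divide_eq_right divide_divide_eq_left mult_ac)
      finally show ?thesis .
    qed
    have "norm (\<Sum>n. F (Suc 0) (of_nat (Suc n))) \<le> 2 ^ (m - Suc 0) * (K / real k ^ N + suminf B)"
    proof (rule norm_sum_derivs_le)
      show "(F i has_field_derivative F (Suc i) x) (at x)"
        if "x \<in> closed_segment (of_nat (Suc n)) (of_nat (Suc (Suc n)))" for i n x
      proof -
        from that obtain t where "x = of_real t" "real (Suc n) \<le> t"
          by (rule closed_segment_of_natE)
        then have "x \<in> - {0}" by auto
        then show ?thesis
          unfolding F_def by (intro has_field_derivative_higher_deriv[OF kernel_holomorphic]) auto
      qed
      \<comment> \<open>For fixed \<open>k\<close> the bound without the exponential factor is
        enough: it is O(1/n) already for i = 0.\<close>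
      show "(\<lambda>n. F i (of_nat (Suc n))) \<longlonglongrightarrow> 0" for i
      proof (rule Lim_null_comparison)
        show "\<forall>\<^sub>F n in sequentially. norm (F i (of_nat (Suc n))) \<le> 2 * fact i * 10 ^ i * inverse (real (Suc n))"
        proof (rule always_eventually, rule allI)
          fix n
          have "norm (F i (of_nat (Suc n))) \<le> 2 * fact i * 10 ^ i / real (Suc n) ^ Suc i"
            using norm_higher_deriv_kernel_le_inverse_power[of "real (Suc n)" i k]
            by (simp add: F_def del: fact_Suc power_Suc of_nat_Suc)
          also have "\<dots> \<le> 2 * fact i * 10 ^ i / real (Suc n) ^ 1"
            by (intro divide_left_mono power_increasing) auto
          finally show "norm (F i (of_nat (Suc n))) \<le> 2 * fact i * 10 ^ i * inverse (real (Suc n))"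
            by (simp only: power_one_right divide_inverse)
        qed
        show "(\<lambda>n. 2 * fact i * 10 ^ i * inverse (real (Suc n))) \<longlonglongrightarrow> 0"
          by (intro tendsto_mult_right_zero LIMSEQ_inverse_real_of_nat)
      qed
      show "summable (\<lambda>n. F (Suc i) (of_nat (Suc n)))" for i
        unfolding F_def by (intro summable_norm_cancel[OF summable_higher_deriv_kernel])
      show "norm (F (Suc m) x) \<le> B n"
        if "x \<in> closed_segment (of_nat (Suc n)) (of_nat (Suc (Suc n)))" for n x
      proof -
        from that obtain t where t: "x = of_real t" "real (Suc n) \<le> t"
          by (rule closed_segment_of_natE)
        then have t1: "t \<ge> 1" by simp
        have "norm (F (Suc m) x) \<le> K / real k ^ N * (1 / t ^ 2)"
          using F_le[OF t1, of "Suc m"] t1 by (simp add: t power2_eq_square mult_ac)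
        also have "\<dots> \<le> B n"
          unfolding B_def using t K0 by (intro mult_left_mono divide_left_mono power_mono) auto
        finally show ?thesis .
      qed
      show "summable B" unfolding B_def
        by (intro summable_mult summable_inverse_Suc_power) auto
      show "norm (F i 1) \<le> K / real k ^ N" if "i < m" for i
        using F_le[of 1 i] that by simp
      show "0 < m" using N by (simp add: m_def)
    qed
    moreover have "suminf B = K / real k ^ N * Z"
      unfolding B_def Z_def by (intro suminf_mult summable_inverse_Suc_power) auto
    moreover have "kernel_coeff k = - (\<Sum>n. F (Suc 0) (of_nat (Suc n)))"
      using summable_norm_cancel[OF summable_higher_deriv_kernel[of 0 k]]
      by (simp add: kernel_coeff_def F_def suminf_minus)
    ultimately show ?thesis by (simp add: algebra_simps add_divide_distrib)
  qed
  then show ?thesis by blast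
qed

section \<open>Growth of the Pochhammer polynomials and convergence of the series\<close>

text \<open>By Bernoulli's inequality the r-th factor is at most 1 + M/r \<le> ((r + 1)/r)^M, and
  the product of these telescopes.\<close>

lemma norm_P_le:
  assumes "norm s \<le> real M"
  shows "norm (P k s) \<le> real (Suc k) ^ M"
proof (induction k)
  case (Suc k)
  have "norm (1 - s / of_nat (Suc k)) \<le> 1 + norm s / real (Suc k)"
    by (rule order.trans[OF norm_triangle_ineq4]) (simp add: norm_divide del: of_nat_Suc)
  also have "\<dots> \<le> 1 + real M * (1 / real (Suc k))"
    using assms by (simp add: divide_right_mono)
  also have "\<dots> \<le> (1 + 1 / real (Suc k)) ^ M"
    by (rule Bernoulli_inequality) (simp add: order.trans[of "- 1" 0])
  finally have "norm (P (Suc k) s) \<le> real (Suc k) ^ M * (1 + 1 / real (Suc k)) ^ M"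
    using Suc.IH by (simp add: P_def norm_mult mult_mono)
  also have "\<dots> = real (Suc (Suc k)) ^ M"
    by (simp add: field_simps flip: power_mult_distrib)
  finally show ?case .
qed (simp add: P_def)

lemma kernel_coeff_P_bound:
  obtains C where "\<And>k s. norm s \<le> real M \<Longrightarrow> norm (kernel_coeff k * P k s) \<le> C / real (Suc k) ^ 2"
proof -
  \<comment> \<open>Decay of order M + 2 beats growth of order M and leaves a summable inverse
    square.\<close>
  define N where "N = M + 2"
  obtain C where C: "norm (kernel_coeff k) \<le> C / real k ^ N" if "k > 0" for k
    using kernel_coeff_decay[of N] by (auto simp: N_def)
  \<comment> \<open>Passing from k to k + 1 in the denominator costs 2^N, because k + 1 \<le> 2k for
    k \<ge> 1; the maximum takes care of k = 0.\<close>
  define D where "D = max (norm (kernel_coeff 0)) (C * 2 ^ N)"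
  have kernel_coeff_le: "norm (kernel_coeff k) \<le> D / real (Suc k) ^ N" for k
  proof (cases "k = 0")
    case False
    have C0: "C \<ge> 0" using order.trans[OF norm_ge_zero C[of 1]] by simp
    have "C / real k ^ N = C * 2 ^ N / (2 * real k) ^ N" by (simp add: power_mult_distrib)
    also have "\<dots> \<le> C * 2 ^ N / real (Suc k) ^ N"
      using False C0 by (intro divide_left_mono power_mono) auto
    also have "\<dots> \<le> D / real (Suc k) ^ N" by (intro divide_right_mono) (auto simp: D_def)
    finally show ?thesis using C[of k] False by simp
  qed (simp add: D_def)
  show ?thesis
  proof (rule that)
    fix k and s :: complex assume s: "norm s \<le> real M"
    have "norm (kernel_coeff k * P k s) \<le> D / real (Suc k) ^ N * real (Suc k) ^ M"
      unfolding norm_mult using kernel_coeff_le[of k] norm_P_le[OF s, of k]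
      by (intro mult_mono) (auto intro: order.trans[OF norm_ge_zero])
    also have "\<dots> = D / real (Suc k) ^ 2"
      by (simp add: N_def power_add power2_eq_square del: of_nat_Suc)
    finally show "norm (kernel_coeff k * P k s) \<le> D / real (Suc k) ^ 2" .
  qed
qed

definition pochhammer_series :: "complex \<Rightarrow> complex" where
  "pochhammer_series s = (\<Sum>k. kernel_coeff k * P k (s / 2))"

lemma pochhammer_series_bounded:
  assumes "bounded K"
  shows "\<exists>M. summable M \<and> (\<forall>k. \<forall>s\<in>K. norm (kernel_coeff k * P k (s / 2)) \<le> M k)"
proof -
  obtain b where b: "\<And>s. s \<in> K \<Longrightarrow> norm s \<le> b"
    using assms by (auto simp: bounded_iff)
  obtain C where C: "\<And>k s. norm s \<le> real (nat \<lceil>b\<rceil>) \<Longrightarrow> norm (kernel_coeff k * P k s) \<le> C / real (Suc k) ^ 2"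
    using kernel_coeff_P_bound[of "nat \<lceil>b\<rceil>"] by blast
  show ?thesis
  proof (intro exI[of _ "\<lambda>k. C / real (Suc k) ^ 2"] conjI allI ballI)
    show "summable (\<lambda>k. C / real (Suc k) ^ 2)"
      using summable_mult[OF summable_inverse_Suc_power[of 2], of C] by simp
    fix k s assume s: "s \<in> K"
    show "norm (kernel_coeff k * P k (s / 2)) \<le> C / real (Suc k) ^ 2"
    proof (rule C)
      have "norm (s / 2) \<le> norm s" by (simp add: norm_divide)
      also have "\<dots> \<le> real (nat \<lceil>b\<rceil>)" using b[OF s] by linarith
      finally show "norm (s / 2) \<le> real (nat \<lceil>b\<rceil>)" .
    qed
  qed
qed

lemma summable_norm_pochhammer_series: "summable (\<lambda>k. norm (kernel_coeff k * P k (s / 2)))"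
proof -
  obtain M where M: "summable M" "\<forall>k. \<forall>s'\<in>{s}. norm (kernel_coeff k * P k (s' / 2)) \<le> M k"
    using pochhammer_series_bounded[of "{s}"] by (auto simp del: norm_mult)
  show ?thesis
    using M(2) by (intro summable_comparison_test'[OF M(1)]) simp
qed

lemma pochhammer_series_sums: "(\<lambda>k. kernel_coeff k * P k (s / 2)) sums pochhammer_series s"
  unfolding pochhammer_series_def
  by (intro summable_sums summable_norm_cancel[OF summable_norm_pochhammer_series])

lemma pochhammer_series_uniform_limit:
  assumes "bounded K"
  shows "uniform_limit K (\<lambda>N s. \<Sum>k<N. kernel_coeff k * P k (s / 2)) pochhammer_series sequentially"
proof -
  obtain M where M: "summable M" "\<forall>k. \<forall>s\<in>K. norm (kernel_coeff k * P k (s / 2)) \<le> M k"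
    using pochhammer_series_bounded[OF assms] by blast
  show ?thesis
    unfolding pochhammer_series_def
    by (rule Weierstrass_m_test[OF _ M(1)]) (use M(2) in blast)
qed

lemma pochhammer_series_holomorphic: "pochhammer_series holomorphic_on UNIV"
proof (rule holomorphic_uniform_sequence)
  show "(\<lambda>s. \<Sum>k<N. kernel_coeff k * P k (s / 2)) holomorphic_on UNIV" for N
    unfolding P_def by (intro holomorphic_intros) auto
  show "\<exists>d>0. cball s d \<subseteq> UNIV \<and>
      uniform_limit (cball s d) (\<lambda>N s. \<Sum>k<N. kernel_coeff k * P k (s / 2)) pochhammer_series sequentially"
    for s
    by (intro exI[of _ 1]) (auto intro: pochhammer_series_uniform_limit)
qed auto

section \<open>Two formulas for the derivative of the kernel\<close>

text \<open>The closed form, suited to summation over \<open>k\<close> by the binomial series. For k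
  = 0 the truncated exponent \<open>k - 1\<close> is harmless because of the factor
  \<open>of_nat k\<close>.\<close>

lemma has_field_derivative_kernel:
  assumes "z \<noteq> 0"
  shows "(kernel k has_field_derivative
    - (1 / z ^ 2 * (1 - 1 / z ^ 2) ^ k - 2 * of_nat k / z ^ 4 * (1 - 1 / z ^ 2) ^ (k - 1))) (at z)"
proof -
  have "((\<lambda>z. 1 - 1 / z ^ 2) has_field_derivative 2 / z ^ 3) (at z)"
  proof (rule DERIV_cong)
    show "((\<lambda>z. 1 - 1 / z ^ 2) has_field_derivative 0 - (0 * z ^ 2 - 1 * (of_nat 2 * (1 * z ^ (2 - Suc 0)))) / (z ^ 2 * z ^ 2)) (at z)"
      by (intro DERIV_diff DERIV_const DERIV_divide DERIV_power DERIV_ident) (simp add: assms)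
  qed (use assms in \<open>simp add: eval_nat_numeral\<close>)
  note deriv = DERIV_divide[OF DERIV_power[OF this, of k] DERIV_ident assms]
  have "(c * (2 / z ^ 3 * a) * z - b * 1) / (z * z) = - (1 / z ^ 2 * b - 2 * c / z ^ 4 * a)" for a b c
  proof -
    have p: "z ^ 3 * z = z ^ 4" "z * z = z ^ 2" by (simp_all add: eval_nat_numeral)
    have "c * (2 / z ^ 3 * a) * z / (z * z) = 2 * c / z ^ 4 * a"
      using assms by (simp add: p(1)[symmetric])
    then show ?thesis by (simp add: diff_divide_distrib p(2))
  qed
  with deriv show ?thesis
    unfolding kernel_def[abs_def] by (simp only: One_nat_def)
qed

text \<open>The expanded form, suited to summation over the integers z = n: the binomial theorem
  writes the kernel in odd powers of 1/z, and differentiation turns these into the even powers that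
  yield zeta values.\<close>

lemma deriv_kernel_eq_sum:
  assumes "z \<noteq> 0"
  shows "deriv (kernel k) z =
    - (\<Sum>j\<le>k. (- 1) ^ j * of_nat (k choose j) * of_nat (2 * j + 1) * (1 / z ^ (2 * j + 2)))"
proof -
  have eq: "(\<Sum>j\<le>k. (- 1) ^ j * of_nat (k choose j) * (1 / w ^ (2 * j + 1))) = kernel k w"
    if "w \<in> - {0}" for w :: complex
  proof -
    have "(1 - 1 / w ^ 2) ^ k = (\<Sum>j\<le>k. of_nat (k choose j) * (- 1 / w ^ 2) ^ j)"
      using binomial_ring[of "- 1 / w ^ 2" 1 k] by simp
    also have "\<dots> / w = (\<Sum>j\<le>k. (- 1) ^ j * of_nat (k choose j) * (1 / w ^ (2 * j + 1)))"
      unfolding sum_divide_distrib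
    proof (intro sum.cong refl)
      fix j
      have "(- 1 / w ^ 2) ^ j = (- 1) ^ j * (1 / w ^ (2 * j))"
        unfolding power_divide by (simp add: power_mult)
      then show "of_nat (k choose j) * (- 1 / w ^ 2) ^ j / w =
          (- 1) ^ j * of_nat (k choose j) * (1 / w ^ (2 * j + 1))"
        by (simp only:) (simp add: mult_ac)
    qed
    finally show ?thesis by (simp add: kernel_def)
  qed
  have "((\<lambda>w. 1 / w ^ (2 * j + 1)) has_field_derivative
      - (of_nat (2 * j + 1) * (1 / z ^ (2 * j + 2)))) (at z)" for j
  proof -
    define q where "q = z ^ (2 * j)"
    have q: "q \<noteq> 0" using assms by (simp add: q_def)
    have "((\<lambda>w. w ^ (2 * j + 1)) has_field_derivative of_nat (2 * j + 1) * q) (at z)"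
      using DERIV_power[OF DERIV_ident, of "2 * j + 1" z UNIV] by (simp only: q_def mult_1 add_diff_cancel_right' flip: One_nat_def)
    then have "((\<lambda>w. inverse (w ^ (2 * j + 1))) has_field_derivative
        - (inverse (z ^ (2 * j + 1)) * (of_nat (2 * j + 1) * q) * inverse (z ^ (2 * j + 1)))) (at z)"
      by (rule DERIV_inverse') (use assms in simp)
    moreover have "z ^ (2 * j + 1) = z * q" "z ^ (2 * j + 2) = z ^ 2 * q"
      by (simp_all add: q_def power_add power2_eq_square)
    moreover have "inverse (z * q) * (c * q) * inverse (z * q) = c * (1 / (z ^ 2 * q))" for c
      using assms q by (simp add: field_simps power2_eq_square)
    ultimately show ?thesis by (simp only: inverse_eq_divide)
  qed
  then have "((\<lambda>w. \<Sum>j\<le>k. (- 1) ^ j * of_nat (k choose j) * (1 / w ^ (2 * j + 1))) has_field_derivative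
      (\<Sum>j\<le>k. (- 1) ^ j * of_nat (k choose j) * - (of_nat (2 * j + 1) * (1 / z ^ (2 * j + 2))))) (at z)"
    by (intro DERIV_sum DERIV_cmult)
  then have "(kernel k has_field_derivative
      (\<Sum>j\<le>k. (- 1) ^ j * of_nat (k choose j) * - (of_nat (2 * j + 1) * (1 / z ^ (2 * j + 2))))) (at z)"
    by (rule has_field_derivative_transform_within_open[where S = "- {0}", OF _ _ _ eq]) (use assms in auto)
  then show ?thesis
    by (simp only: DERIV_imp_deriv mult_minus_right sum_negf mult.assoc)
qed

section \<open>The Dirichlet series in its half-plane of convergence\<close>

text \<open>Stands in for \<open>zeta\<close> until the continuation is known to exist; it is used
  only for real part greater than 1.\<close>

definition zeta_series :: "complex \<Rightarrow> complex" where
  "zeta_series s = (\<Sum>n. 1 / of_nat (Suc n) powr s)"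

lemma norm_zeta_term: "norm (1 / of_nat (Suc n) powr s :: complex) = real (Suc n) powr - Re s"
  unfolding norm_divide norm_one powr_minus_divide
  by (subst norm_powr_real_powr) (simp_all del: of_nat_Suc)

lemma summable_Suc_powr:
  assumes "c > 1"
  shows "summable (\<lambda>n. real (Suc n) powr - c)"
  unfolding summable_Suc_iff[of "\<lambda>n. real n powr - c"] summable_real_powr_iff
  using assms by simp

lemma zeta_series_sums:
  assumes "Re s > 1"
  shows "(\<lambda>n. 1 / of_nat (Suc n) powr s) sums zeta_series s"
proof -
  have "summable (\<lambda>n. norm (1 / of_nat (Suc n) powr s))"
    unfolding norm_zeta_term by (rule summable_Suc_powr[OF assms])
  then show ?thesis
    unfolding zeta_series_def by (rule summable_sums[OF summable_norm_cancel])
qed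

lemma zeta_series_holomorphic: "zeta_series holomorphic_on {s. Re s > 1}"
proof (rule holomorphic_uniform_sequence)
  show "open {s. Re s > 1}" by (rule open_halfspace_Re_gt)
  show "(\<lambda>s. \<Sum>n<N. 1 / of_nat (Suc n) powr s) holomorphic_on {s. Re s > 1}" for N
    by (intro holomorphic_intros) (auto simp del: of_nat_Suc)
  fix s assume "s \<in> {s. Re s > 1}"
  then have s: "Re s > 1" by simp
  \<comment> \<open>Half the distance from \<open>s\<close> to the line Re = 1, so that the closed
    disc stays in Re w \<ge> 1 + d, where one convergent majorant serves all w.\<close>
  define d where "d = (Re s - 1) / 2"
  have d: "d > 0" using s by (simp add: d_def)
  have Re_ge: "Re w \<ge> 1 + d" if "w \<in> cball s d" for w
    using that abs_Re_le_cmod[of "s - w"] by (simp add: dist_norm d_def field_simps)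
  have "uniform_limit (cball s d) (\<lambda>N s. \<Sum>n<N. 1 / of_nat (Suc n) powr s) zeta_series sequentially"
    unfolding zeta_series_def
  proof (rule Weierstrass_m_test)
    show "norm (1 / of_nat (Suc n) powr w) \<le> real (Suc n) powr - (1 + d)" if "w \<in> cball s d" for n w
      unfolding norm_zeta_term using Re_ge[OF that] by (intro powr_mono) auto
    show "summable (\<lambda>n. real (Suc n) powr - (1 + d))"
      using s by (intro summable_Suc_powr) (simp add: d_def)
  qed
  moreover have "cball s d \<subseteq> {s. Re s > 1}" using Re_ge d by fastforce
  ultimately show "\<exists>d>0. cball s d \<subseteq> {s. Re s > 1} \<and>
      uniform_limit (cball s d) (\<lambda>N s. \<Sum>n<N. 1 / of_nat (Suc n) powr s) zeta_series sequentially"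
    using d by blast
qed

lemma kernel_coeff_eq_zeta_series:
  "kernel_coeff k = (\<Sum>j\<le>k. (- 1) ^ j * of_nat (k choose j) * of_nat (2 * j + 1) * zeta_series (of_nat (2 * j + 2)))"
proof -
  have powr: "of_nat (Suc n) powr of_nat p = (of_nat (Suc n) ^ p :: complex)" for n p
    by (rule powr_complexpow) (rule of_nat_neq_0)
  have "(\<lambda>n. 1 / of_nat (Suc n) ^ (2 * j + 2)) sums zeta_series (of_nat (2 * j + 2))" for j
    using zeta_series_sums[of "of_nat (2 * j + 2)", unfolded powr] by simp
  then have "(\<lambda>n. \<Sum>j\<le>k. (- 1) ^ j * of_nat (k choose j) * of_nat (2 * j + 1) * (1 / of_nat (Suc n) ^ (2 * j + 2)))
      sums (\<Sum>j\<le>k. (- 1) ^ j * of_nat (k choose j) * of_nat (2 * j + 1) * zeta_series (of_nat (2 * j + 2)))"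
    by (intro sums_sum sums_mult)
  then show ?thesis
    unfolding kernel_coeff_def deriv_kernel_eq_sum[OF of_nat_neq_0] minus_minus
    by (rule sums_unique[symmetric])
qed

section \<open>Double series and the binomial series\<close>

lemma suminf_eq_infsum:
  fixes f :: "nat \<Rightarrow> complex"
  assumes "f summable_on UNIV"
  shows "suminf f = infsum f UNIV"
  using has_sum_imp_sums[OF has_sum_infsum[OF assms]] by (simp add: sums_iff)

text \<open>The product majorant makes the family absolutely summable over all pairs. Unordered sums
  may then be interchanged, and each of them equals the corresponding ordinary series.\<close>

lemma suminf_swap:
  fixes f :: "nat \<Rightarrow> nat \<Rightarrow> complex" and u v :: "nat \<Rightarrow> real"
  assumes bound: "\<And>m n. norm (f m n) \<le> u m * v n"
    and u: "summable u" "\<And>m. u m \<ge> 0" and v: "summable v" "\<And>n. v n \<ge> 0"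
  shows "(\<Sum>m. \<Sum>n. f m n) = (\<Sum>n. \<Sum>m. f m n)"
proof -
  have uv: "u summable_on UNIV" "v summable_on UNIV"
    using u v by (simp_all add: summable_on_UNIV_nonneg_real_iff)
  have "(\<lambda>(m, n). u m * v n) summable_on UNIV \<times> UNIV"
  proof (rule summable_on_SigmaI)
    show "((\<lambda>n. case (m, n) of (m, n) \<Rightarrow> u m * v n) has_sum u m * infsum v UNIV) UNIV" for m
      using has_sum_cmult_right[OF has_sum_infsum[OF uv(2)]] by simp
    show "(\<lambda>m. u m * infsum v UNIV) summable_on UNIV"
      by (rule summable_on_cmult_left[OF uv(1)])
  qed (use u v in auto)
  then have "(\<lambda>x. norm ((\<lambda>(m, n). f m n) x)) summable_on UNIV \<times> UNIV"
    by (rule Infinite_Sum.abs_summable_on_comparison_test') (use bound in auto)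
  then have sum1: "(\<lambda>(m, n). f m n) summable_on UNIV \<times> UNIV"
    by (rule Infinite_Sum.abs_summable_summable)
  have sum2: "(\<lambda>(n, m). f m n) summable_on UNIV \<times> UNIV"
    using summable_on_swap[THEN iffD1, OF sum1] by simp
  have "(\<Sum>m. \<Sum>n. f m n) = (\<Sum>\<^sub>\<infinity>m. \<Sum>\<^sub>\<infinity>n. f m n)"
    using summable_on_SigmaD1[OF sum1] summable_on_Sigma_banach[OF sum1]
    by (simp add: suminf_eq_infsum)
  also have "\<dots> = (\<Sum>\<^sub>\<infinity>n. \<Sum>\<^sub>\<infinity>m. f m n)"
    by (rule infsum_swap_banach[OF sum1])
  also have "\<dots> = (\<Sum>n. \<Sum>m. f m n)"
    using summable_on_SigmaD1[OF sum2] summable_on_Sigma_banach[OF sum2]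
    by (simp add: suminf_eq_infsum)
  finally show ?thesis .
qed

lemma P_Suc: "P (Suc k) s = P k s * (1 - s / of_nat (Suc k))"
  by (simp add: P_def)

text \<open>This makes the values P_k(s) the Taylor coefficients of (1 - y)^(s-1) in y.\<close>

lemma P_eq_gbinomial: "P k s = (- 1) ^ k * ((s - 1) gchoose k)"
proof (induction k)
  case (Suc k)
  have "of_nat (Suc k) * ((s - 1) gchoose Suc k) = (s - 1 - of_nat k) * ((s - 1) gchoose k)"
    using gbinomial_mult_1[of "s - 1" k] by (simp add: algebra_simps)
  then have "(s - 1) gchoose Suc k = - (((s - 1) gchoose k) * (1 - s / of_nat (Suc k)))"
    by (simp add: field_simps del: of_nat_Suc) (simp add: algebra_simps)
  then show ?case using Suc.IH by (simp add: P_Suc)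
qed (simp add: P_def)

lemma P_power_sums:
  assumes "norm y < 1"
  shows "(\<lambda>k. P k s * y ^ k) sums (1 - y) powr (s - 1)"
proof -
  have "(\<lambda>k. ((s - 1) gchoose k) * (- y) ^ k) sums (1 + - y) powr (s - 1)"
    by (rule gen_binomial_complex) (use assms in simp)
  then show ?thesis by (simp add: P_eq_gbinomial power_minus[of y] mult_ac)
qed

text \<open>The absorption identity for binomial coefficients. It allows the differentiated binomial
  series to be summed as another binomial series, with s - 1 in place of s, instead of
  differentiating term by term.\<close>

lemma Suc_mult_P_Suc: "of_nat (Suc k) * P (Suc k) s = - (s - 1) * P k (s - 1)"
proof -
  have "of_nat (Suc k) * P (Suc k) s = (- 1) ^ Suc k * (of_nat (Suc k) * ((s - 1) gchoose Suc k))"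
    by (simp only: P_eq_gbinomial mult.left_commute)
  also have "\<dots> = - (s - 1) * P k (s - 1)"
    unfolding gbinomial_absorption by (simp add: P_eq_gbinomial algebra_simps)
  finally show ?thesis .
qed

lemma P_power_deriv_sums:
  assumes "norm y < 1"
  shows "(\<lambda>k. of_nat k * P k s * y ^ (k - 1)) sums (- (s - 1) * (1 - y) powr (s - 2))"
proof -
  have "(\<lambda>k. - (s - 1) * (P k (s - 1) * y ^ k)) sums (- (s - 1) * (1 - y) powr (s - 2))"
    using sums_mult[OF P_power_sums[OF assms, of "s - 1"], of "- (s - 1)"] by simp
  also have "(\<lambda>k. - (s - 1) * (P k (s - 1) * y ^ k)) =
      (\<lambda>k. of_nat (Suc k) * P (Suc k) s * y ^ (Suc k - 1))"
    by (simp only: Suc_mult_P_Suc diff_Suc_1 mult.assoc)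
  \<comment> \<open>The index shift adds only the term k = 0, which vanishes because of the factor
    \<open>of_nat k\<close>.\<close>
  finally show ?thesis
    using sums_Suc[of "\<lambda>k. of_nat k * P k s * y ^ (k - 1)"] by (simp del: of_nat_Suc)
qed

text \<open>Put w = 1/N^2 with N = n + 1 and y = 1 - w in the binomial series and its derivative.
  The closed form of the kernel derivative then sums to w w^(s-1) + 2 (s - 1) w^2 w^(s-2) = (2s - 1)
  w^s. Replacing s by s/2 gives (s - 1) times a term of the Dirichlet series.\<close>

lemma deriv_kernel_P_sums:
  "(\<lambda>k. - deriv (kernel k) (of_nat (Suc n)) * P k s) sums ((2 * s - 1) / of_nat (Suc n) powr (2 * s))"
proof -
  define N :: complex where "N = of_nat (Suc n)"
  define w where "w = 1 / N ^ 2"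
  have N: "N \<noteq> 0" unfolding N_def by (rule of_nat_neq_0)
  have w: "w \<noteq> 0" using N by (simp add: w_def)
  have w_real: "w = of_real (1 / real (Suc n) ^ 2)" by (simp add: w_def N_def)
  have "1 - w = of_real (1 - 1 / real (Suc n) ^ 2)" by (simp add: w_real)
  moreover have "\<bar>1 - 1 / real (Suc n) ^ 2\<bar> < 1"
    by (simp add: abs_less_iff field_simps)
  ultimately have "norm (1 - w) < 1" by (simp only: norm_of_real)
  note sums = P_power_sums[OF this, of s] P_power_deriv_sums[OF this, of s]
  have "(\<lambda>k. w * (P k s * (1 - w) ^ k) - 2 * w ^ 2 * (of_nat k * P k s * (1 - w) ^ (k - 1))) sums
      (w * w powr (s - 1) - 2 * w ^ 2 * (- (s - 1) * w powr (s - 2)))"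
    using sums by (intro sums_diff sums_mult) simp_all
  also have "(\<lambda>k. w * (P k s * (1 - w) ^ k) - 2 * w ^ 2 * (of_nat k * P k s * (1 - w) ^ (k - 1))) =
      (\<lambda>k. - deriv (kernel k) N * P k s)"
    by (simp add: DERIV_imp_deriv[OF has_field_derivative_kernel[OF N]] w_def power_divide algebra_simps
        flip: power_mult)
  also have "w * w powr (s - 1) - 2 * w ^ 2 * (- (s - 1) * w powr (s - 2)) = (2 * s - 1) * w powr s"
    using w by (simp add: powr_diff power2_eq_square field_simps)
  also have "w powr s = 1 / N powr (2 * s)"
  proof -
    \<comment> \<open>Powers of products split here because the bases are nonnegative reals; for
      general complex bases the branch of the logarithm would interfere.\<close>
    have "(N * N * w) powr s = (N * N) powr s * w powr s"
      by (rule powr_times_real) (simp_all add: N_def w_real)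
    also have "(N * N) powr s = N powr s * N powr s"
      by (rule powr_times_real) (simp_all add: N_def)
    also have "\<dots> = N powr (2 * s)" by (simp only: mult_2 powr_add)
    finally have "N powr (2 * s) * w powr s = (N * N * w) powr s" ..
    also have "N * N * w = 1" using N by (simp add: w_def power2_eq_square)
    finally show ?thesis using N by (simp add: field_simps)
  qed
  finally show ?thesis by (simp add: N_def)
qed

section \<open>Interchange of the two sums near s = 7\<close>

text \<open>A bound that separates \<open>n\<close> from \<open>k\<close>, as the product majorant
  in \<open>suminf_swap\<close> requires; at integers all powers of 1 - 1/n^2 lie between 0 and
  1.\<close>

lemma norm_deriv_kernel_of_nat_le:
  "norm (deriv (kernel k) (of_nat (Suc n))) \<le> 1 / real (Suc n) ^ 2 * (2 * real k + 1)"
proof -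
  define x where "x = 1 / real (Suc n) ^ 2"
  have x: "0 \<le> x" "x \<le> 1" by (simp_all add: x_def)
  have "- deriv (kernel k) (of_nat (Suc n)) = of_real (x * (1 - x) ^ k - 2 * real k * x * (x * (1 - x) ^ (k - 1)))"
    by (subst DERIV_imp_deriv[OF has_field_derivative_kernel[OF of_nat_neq_0]])
       (simp add: x_def power4_eq_xxxx power2_eq_square del: of_nat_Suc)
  then have "norm (deriv (kernel k) (of_nat (Suc n))) = \<bar>x * (1 - x) ^ k - 2 * real k * x * (x * (1 - x) ^ (k - 1))\<bar>"
    by (metis norm_minus_cancel norm_of_real)
  also have "\<dots> \<le> \<bar>x * (1 - x) ^ k\<bar> + \<bar>2 * real k * x * (x * (1 - x) ^ (k - 1))\<bar>"
    by (rule abs_triangle_ineq4)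
  also have "\<dots> = x * (1 - x) ^ k + 2 * real k * x * (x * (1 - x) ^ (k - 1))"
    using x by simp
  also have "\<dots> \<le> x * 1 + 2 * real k * x * (1 * 1)"
    using x by (intro add_mono mult_mono power_le_one mult_nonneg_nonneg zero_le_power) auto
  also have "\<dots> = x * (2 * real k + 1)" by (simp add: algebra_simps)
  finally show ?thesis unfolding x_def .
qed

text \<open>
  The disc is chosen so that \<open>|1 - s / r| \<le> 1 - 3 / r\<close> for \<open>r \<ge> 4\<close>, whence \<open>P k s = O(k^-3)\<close>.
\<close>
lemma summable_P_weighted:
  assumes "norm (s - 7 / 2) \<le> 1 / 2"
  shows "summable (\<lambda>k. (2 * real k + 1) * norm (P k s))"
proof -
  define D where "D = 6 * norm (P 3 s)"
  \<comment> \<open>The product of (r - 3)/r over r from 4 to k + 3 telescopes to 6/((k + 1)(k +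
    2)(k + 3)), whence the 6 in \<open>D\<close>.\<close>
  have P_le: "norm (P (k + 3) s) \<le> D / ((real k + 1) * (real k + 2) * (real k + 3))" for k
  proof (induction k)
    case (Suc k)
    have "1 - s / of_nat (k + 4) = (of_nat (k + 4) - s) / of_nat (k + 4)"
      by (simp add: diff_divide_distrib del: of_nat_add)
    also have "of_nat (k + 4) - s = of_real (real k + 1 / 2) - (s - 7 / 2)"
      by (simp add: algebra_simps)
    also have "norm (\<dots> / of_nat (k + 4)) \<le> (real k + 1 / 2 + 1 / 2) / real (k + 4)"
    proof -
      have "norm (of_real (real k + 1 / 2) - (s - 7 / 2)) \<le> real k + 1 / 2 + 1 / 2"
        using norm_triangle_ineq4[of "of_real (real k + 1 / 2)" "s - 7 / 2"] assms
        unfolding norm_of_real by simp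
      then show ?thesis unfolding norm_divide norm_of_nat by (rule divide_right_mono) simp
    qed
    also have "\<dots> = (real k + 1) / (real k + 4)" by simp
    finally have "norm (P (k + 3) s) * norm (1 - s / of_nat (k + 4)) \<le>
        D / ((real k + 1) * (real k + 2) * (real k + 3)) * ((real k + 1) / (real k + 4))"
      by (intro mult_mono Suc.IH) (auto simp: D_def)
    then show ?case
      using P_Suc[of "k + 3" s] by (simp add: norm_mult add_ac)
  qed (simp add: D_def numeral_3_eq_3)
  have "summable (\<lambda>k. (2 * real (k + 3) + 1) * norm (P (k + 3) s))"
  proof (rule summable_comparison_test')
    show "summable (\<lambda>k. 4 * D * (1 / real (Suc k) ^ 2))"
      by (intro summable_mult summable_inverse_Suc_power) auto
    fix k
    have D: "D \<ge> 0" by (simp add: D_def)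
    have "norm ((2 * real (k + 3) + 1) * norm (P (k + 3) s)) \<le>
        (2 * real (k + 3) + 1) * (D / ((real k + 1) * (real k + 2) * (real k + 3)))"
      using mult_left_mono[OF P_le[of k], of "2 * real (k + 3) + 1"] by simp
    also have "\<dots> = D * ((2 * real k + 7) / ((real k + 1) * (real k + 2) * (real k + 3)))"
      by simp
    also have "\<dots> \<le> D * (4 / (real k + 1) ^ 2)"
    proof (intro mult_left_mono D)
      have "(2 * real k + 7) / ((real k + 1) * (real k + 2) * (real k + 3)) =
          (2 * real k + 7) * (real k + 1) / ((real k + 2) * (real k + 3)) / (real k + 1) ^ 2"
        by (simp add: power2_eq_square)
      also have "\<dots> \<le> 4 / (real k + 1) ^ 2"
      proof (rule divide_right_mono)
        show "(2 * real k + 7) * (real k + 1) / ((real k + 2) * (real k + 3)) \<le> 4"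
          by (rule pos_divide_le_eq[THEN iffD2]) (intro mult_pos_pos, simp_all add: algebra_simps)
      qed simp
      finally show "(2 * real k + 7) / ((real k + 1) * (real k + 2) * (real k + 3)) \<le> 4 / (real k + 1) ^ 2" .
    qed
    finally show "norm ((2 * real (k + 3) + 1) * norm (P (k + 3) s)) \<le> 4 * D * (1 / real (Suc k) ^ 2)"
      by (simp add: add_ac mult.commute)
  qed
  then show ?thesis by (simp only: summable_iff_shift[where f = "\<lambda>k. (2 * real k + 1) * norm (P k s)"])
qed

text \<open>Halving maps this ball into the disc of radius 1/2 about 7/2, where
  \<open>summable_P_weighted\<close> makes the double series absolutely convergent. Summing over
  \<open>k\<close> first then produces the Dirichlet series.\<close>

lemma pochhammer_series_eq_zeta_series_ball:
  assumes s: "s \<in> ball 7 1"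
  shows "pochhammer_series s = (s - 1) * zeta_series s"
proof -
  define f where "f n k = - deriv (kernel k) (of_nat (Suc n)) * P k (s / 2)" for n k
  have "Re s > 1" using s abs_Re_le_cmod[of "7 - s"] by (simp add: dist_norm)
  have half: "norm (s / 2 - 7 / 2) \<le> 1 / 2"
    using s by (simp add: dist_norm norm_minus_commute norm_divide flip: diff_divide_distrib)
  have "kernel_coeff k * P k (s / 2) = (\<Sum>n. f n k)" for k
    using summable_norm_cancel[OF summable_higher_deriv_kernel[of 0 k]]
    unfolding kernel_coeff_def f_def by (intro suminf_mult2 summable_minus) simp
  then have "pochhammer_series s = (\<Sum>k. \<Sum>n. f n k)"
    by (simp add: pochhammer_series_def)
  also have "\<dots> = (\<Sum>n. \<Sum>k. f n k)"
  proof (rule suminf_swap[symmetric])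
    show "norm (f n k) \<le> 1 / real (Suc n) ^ 2 * ((2 * real k + 1) * norm (P k (s / 2)))" for n k
      using mult_right_mono[OF norm_deriv_kernel_of_nat_le, of "norm (P k (s / 2))"]
      by (simp add: f_def norm_mult mult.assoc del: of_nat_Suc)
    show "summable (\<lambda>n. 1 / real (Suc n) ^ 2)" by (rule summable_inverse_Suc_power) simp
    show "summable (\<lambda>k. (2 * real k + 1) * norm (P k (s / 2)))" by (rule summable_P_weighted[OF half])
  qed auto
  also have "\<dots> = (\<Sum>n. (s - 1) * (1 / of_nat (Suc n) powr s))"
    using sums_unique[OF deriv_kernel_P_sums[of _ "s / 2"]] by (simp add: f_def)
  also have "\<dots> = (s - 1) * zeta_series s"
    unfolding zeta_series_def using zeta_series_sums[OF \<open>Re s > 1\<close>]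
    by (intro suminf_mult) (simp add: sums_iff)
  finally show ?thesis .
qed

section \<open>Analytic continuation and identification with zeta\<close>

lemma pochhammer_series_eq_zeta_series:
  assumes "Re s > 1"
  shows "pochhammer_series s = (s - 1) * zeta_series s"
proof (rule analytic_continuation_open[of "ball 7 1" "{s. Re s > 1}"
      pochhammer_series "\<lambda>s. (s - 1) * zeta_series s" s])
  show "connected {s. Re s > 1}" by (intro convex_connected convex_halfspace_Re_gt)
  show "ball 7 1 \<subseteq> {s. Re s > 1}"
  proof
    fix z :: complex assume "z \<in> ball 7 1"
    then show "z \<in> {s. Re s > 1}" using abs_Re_le_cmod[of "7 - z"] by (simp add: dist_norm)
  qed
  show "pochhammer_series holomorphic_on {s. Re s > 1}"
    by (rule holomorphic_on_subset[OF pochhammer_series_holomorphic]) simp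
  show "(\<lambda>s. (s - 1) * zeta_series s) holomorphic_on {s. Re s > 1}"
    by (intro holomorphic_intros zeta_series_holomorphic)
qed (use assms in \<open>auto simp: open_halfspace_Re_gt pochhammer_series_eq_zeta_series_ball simp del: mem_ball\<close>)

text \<open>Evaluates the definite description. The quotient is a continuation of the Dirichlet
  series, and any other one agrees with it on the connected punctured plane by the identity theorem;
  the value at 1 is fixed by the normalisation.\<close>

lemma zeta_eq: "zeta = (\<lambda>s. if s = 1 then 0 else pochhammer_series s / (s - 1))"
  unfolding zeta_def
proof (rule the_equality)
  let ?f = "\<lambda>s. if s = 1 then 0 else pochhammer_series s / (s - 1)"
  have "(\<lambda>s. pochhammer_series s / (s - 1)) holomorphic_on - {1}"
    by (intro holomorphic_intros holomorphic_on_subset[OF pochhammer_series_holomorphic]) auto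
  then have holo: "?f holomorphic_on - {1}" by (rule holomorphic_transform) auto
  have series: "?f s = zeta_series s" if "Re s > 1" for s
    using that by (auto simp: pochhammer_series_eq_zeta_series)
  show "?f holomorphic_on - {1} \<and> (\<forall>s. Re s > 1 \<longrightarrow> (\<lambda>n. 1 / of_nat (Suc n) powr s) sums ?f s) \<and> ?f 1 = 0"
  proof (intro conjI allI impI holo)
    fix s :: complex assume s: "Re s > 1"
    show "(\<lambda>n. 1 / of_nat (Suc n) powr s) sums ?f s"
      unfolding series[OF s] by (rule zeta_series_sums[OF s])
  qed simp
  fix g :: "complex \<Rightarrow> complex"
  assume g: "g holomorphic_on - {1} \<and> (\<forall>s. Re s > 1 \<longrightarrow> (\<lambda>n. 1 / of_nat (Suc n) powr s) sums g s) \<and> g 1 = 0"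
  show "g = ?f"
  proof
    fix s
    show "g s = ?f s"
    proof (cases "s = 1")
      case False
      show ?thesis
      proof (rule analytic_continuation_open[of "{s. Re s > 1}" "- {1}" g ?f])
        show "{s. Re s > 1} \<noteq> {}" by (auto intro: exI[of _ 2])
        show "connected (- {1 :: complex})" by (rule connected_punctured_universe) simp
        show "g z = ?f z" if "z \<in> {s. Re s > 1}" for z
        proof -
          have z: "Re z > 1" using that by simp
          then have "(\<lambda>n. 1 / of_nat (Suc n) powr z) sums g z" using g by blast
          then have "g z = zeta_series z" by (rule sums_unique2) (rule zeta_series_sums[OF z])
          then show ?thesis by (simp only: series[OF z])
        qed
        show "g holomorphic_on - {1}" using g by blast
        show "?f holomorphic_on - {1}" by (rule holo)
        show "open {s. Re s > 1}" by (rule open_halfspace_Re_gt)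
        show "{s. Re s > 1} \<subseteq> - {1}" by auto
        show "s \<in> - {1}" using False by simp
      qed (rule open_delete[OF open_UNIV, of 1, folded Compl_eq_Diff_UNIV])
    next
      case True
      then show ?thesis using g by (simp only: if_True simp_thms)
    qed
  qed
qed

lemma zeta_eq_zeta_series: "Re s > 1 \<Longrightarrow> zeta s = zeta_series s"
  by (auto simp: zeta_eq pochhammer_series_eq_zeta_series)

lemma A_eq_kernel_coeff: "A k = kernel_coeff k"
proof -
  have "zeta (of_nat (2 * j + 2)) = zeta_series (of_nat (2 * j + 2))" for j
    by (rule zeta_eq_zeta_series) simp
  then show ?thesis unfolding A_def kernel_coeff_eq_zeta_series by (simp add: atLeast0AtMost)
qed

lemma entire_zeta_eq: "entire_zeta = pochhammer_series"
proof
  fix s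
  have "(\<lambda>z. (z - 1) * zeta z) \<midarrow>s\<rightarrow> pochhammer_series s"
  proof (rule Lim_transform_eventually)
    have "isCont pochhammer_series s"
      using holomorphic_on_imp_continuous_on[OF pochhammer_series_holomorphic]
      by (simp add: continuous_on_eq_continuous_at)
    then show "pochhammer_series \<midarrow>s\<rightarrow> pochhammer_series s" by (rule isContD)
    \<comment> \<open>The filter \<open>at s\<close> leaves out s itself, so this covers s = 1 as
      well and gives the limit that \<open>remove_sings\<close> fills in there.\<close>
    have "\<forall>\<^sub>F z in at s. z \<noteq> 1" by (rule eventually_neq_at_within)
    then show "\<forall>\<^sub>F z in at s. pochhammer_series z = (z - 1) * zeta z"
      by eventually_elim (simp add: zeta_eq)
  qed
  then show "entire_zeta s = pochhammer_series s"
    unfolding entire_zeta_def by (rule remove_sings_eqI)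
qed

theorem theorem2p1:
  shows "(\<forall>s::complex. (\<lambda>k. A k * P k (s / 2)) sums entire_zeta s) \<and>
         (\<forall>K::complex set. compact K \<longrightarrow>
            (\<forall>s\<in>K. summable (\<lambda>k. norm (A k * P k (s / 2)))) \<and>
            uniform_limit K (\<lambda>N s. \<Sum>k<N. A k * P k (s / 2)) entire_zeta sequentially)"
  unfolding A_eq_kernel_coeff entire_zeta_eq
  by (intro conjI allI impI ballI pochhammer_series_sums summable_norm_pochhammer_series
      pochhammer_series_uniform_limit compact_imp_bounded)

end
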